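(* Let $L$ and $L'$ be two $\mathfrak{so}(n)$-valued Lax operators with the same Tyurin parameters $\{(\alpha_s,\gamma_s)\}$. Then their pointwise commutator $[L,L']=LL'-L'L$ is again an $\mathfrak{so}(n)$-valued Lax operator with these Tyurin parameters; that is, the defining conditions of $\mathfrak{so}(n)$-valued Lax operators at the points $\gamma_s$ are invariant with respect to the Lie bracket.
   Context: $\Gamma$ is a compact Riemann surface of genus $g$ with two distinct marked points $P_+,P_-$. Fix further distinct points $\gamma_s\in\Gamma\setminus\{P_+,P_-\}$, $s=1,\ldots,ng$, and nonzero vectors $\alpha_s\in\mathbb{C}^n$ with $\alpha_s^t\alpha_s=0$; the pairs $(\alpha_s,\gamma_s)$ are called Tyurin parameters. $\mathfrak{so}(n)$ is the Lie algebra of complex $n\times n$ matrices $X$ with $X^t=-X$. An $\mathfrak{so}(n)$-valued Lax operator is a meromorphic function $L:\Gamma\to\mathfrak{so}(n)$, holomorphic outside $P_\pm$ and the $\gamma_s$ (poles of arbitrary finite order are allowed at $P_\pm$), such that at every $\gamma_s$, with $z$ a local coordinate vanishing at $\gamma_s$ and omitting the index $s$, $$L=\frac{L_{-1}}{z}+L_0+O(z),$$ where the coefficients are skew-symmetric, $L_{-1}=\alpha\beta^t-\beta\alpha^t$ for some $\beta\in\mathbb{C}^n$ (depending on $L$ and $s$) with $\beta^t\alpha=0$, and $L_0\alpha=k\alpha$ for some $k\in\mathbb{C}$. *)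

theory Defs
  imports "HOL-Homology.Homology" "HOL-Complex_Analysis.Complex_Analysis"
begin

text \<open>A chart is a pair of an open domain \<open>U\<close> and a coordinate map \<open>\<phi>\<close>. Only the values
  of \<open>\<phi>\<close> on \<open>U\<close> matter; the inverse coordinate map is \<open>inv_into U \<phi>\<close>.\<close>

type_synonym 'a chart = "'a set \<times> ('a \<Rightarrow> complex)"

definition complex_chart :: "'a topology \<Rightarrow> 'a chart \<Rightarrow> bool" where
  "complex_chart X = (\<lambda>(U, \<phi>). openin X U \<and> open (\<phi> ` U) \<and>
     homeomorphic_map (subtopology X U) (top_of_set (\<phi> ` U)) \<phi>)"

definition compatible_charts :: "'a chart \<Rightarrow> 'a chart \<Rightarrow> bool" where
  "compatible_charts = (\<lambda>(U, \<phi>) (V, \<psi>).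
     (\<psi> \<circ> inv_into U \<phi>) holomorphic_on \<phi> ` (U \<inter> V) \<and>
     (\<phi> \<circ> inv_into V \<psi>) holomorphic_on \<psi> ` (U \<inter> V))"

text \<open>Second countability is not required: it follows from connectedness (Rado), and directly in
  the compact case.\<close>

definition riemann_surface :: "'a topology \<Rightarrow> 'a chart set \<Rightarrow> bool" where
  "riemann_surface X A \<longleftrightarrow>
     topspace X \<noteq> {} \<and> connected_space X \<and> Hausdorff_space X \<and>
     (\<forall>c\<in>A. complex_chart X c) \<and> (\<Union>c\<in>A. fst c) = topspace X \<and>
     (\<forall>c\<in>A. \<forall>d\<in>A. compatible_charts c d)"

text \<open>The genus is half the first Betti number: \<open>H\<^sub>1(X; \<int>)\<close> is free abelian of rank \<open>2g\<close>.\<close>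

definition has_genus :: "'a topology \<Rightarrow> nat \<Rightarrow> bool" where
  "has_genus X g \<longleftrightarrow> homology_group 1 X \<cong> free_Abelian_group {..<2 * g}"

definition compact_riemann_surface :: "'a topology \<Rightarrow> 'a chart set \<Rightarrow> nat \<Rightarrow> bool" where
  "compact_riemann_surface X A g \<longleftrightarrow>
     riemann_surface X A \<and> compact_space X \<and> has_genus X g"

text \<open>A local coordinate vanishing at \<open>p\<close> is any chart of the maximal atlas containing \<open>A\<close>
  that sends \<open>p\<close> to 0.\<close>

definition local_coordinate_at ::
  "'a topology \<Rightarrow> 'a chart set \<Rightarrow> 'a \<Rightarrow> 'a chart \<Rightarrow> bool" where
  "local_coordinate_at X A p c \<longleftrightarrow>
     complex_chart X c \<and> (\<forall>d\<in>A. compatible_charts c d) \<and> p \<in> fst c \<and> snd c p = 0"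

definition holomorphic_on_surface :: "'a chart set \<Rightarrow> ('a \<Rightarrow> complex) \<Rightarrow> 'a set \<Rightarrow> bool" where
  "holomorphic_on_surface A f S \<longleftrightarrow>
     (\<forall>(U, \<phi>)\<in>A. (f \<circ> inv_into U \<phi>) holomorphic_on \<phi> ` (U \<inter> S))"

text \<open>Functions are total, so a meromorphic function carries arbitrary values at its poles;
  those values play no role anywhere below.\<close>

definition meromorphic_on_surface :: "'a chart set \<Rightarrow> ('a \<Rightarrow> complex) \<Rightarrow> 'a set \<Rightarrow> bool" where
  "meromorphic_on_surface A f S \<longleftrightarrow>
     (\<forall>(U, \<phi>)\<in>A. (f \<circ> inv_into U \<phi>) meromorphic_on \<phi> ` (U \<inter> S))"

definition so_algebra :: "(complex^'n^'n) set" where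
  "so_algebra = {M. transpose M = - M}"

definition outer :: "complex^'n \<Rightarrow> complex^'n \<Rightarrow> complex^'n^'n" where
  "outer a b = (\<chi> i j. a $ i * b $ j)"

text \<open>\<open>scalar_product a b\<close> is the complex bilinear \<open>a\<^sup>t b\<close>, without conjugation.\<close>

definition tyurin_parameters ::
  "'a topology \<Rightarrow> nat \<Rightarrow> 'a \<Rightarrow> 'a \<Rightarrow> (nat \<Rightarrow> complex^'n) \<Rightarrow> (nat \<Rightarrow> 'a) \<Rightarrow> bool" where
  "tyurin_parameters X g Pp Pm \<alpha> \<gamma> \<longleftrightarrow>
     inj_on \<gamma> {1..CARD('n) * g} \<and>
     (\<forall>s\<in>{1..CARD('n) * g}. \<gamma> s \<in> topspace X - {Pp, Pm} \<and>
        \<alpha> s \<noteq> 0 \<and> scalar_product (\<alpha> s) (\<alpha> s) = 0)"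

definition tyurin_expansion ::
  "'a chart \<Rightarrow> complex^'n \<Rightarrow> ('a \<Rightarrow> complex^'n^'n) \<Rightarrow> bool" where
  "tyurin_expansion = (\<lambda>(U, \<phi>) a L. \<exists>Lm1\<in>so_algebra. \<exists>L0\<in>so_algebra.
     (\<forall>i j. (\<lambda>z. L (inv_into U \<phi> z) $ i $ j - (Lm1 $ i $ j / z + L0 $ i $ j))
              \<in> O[at 0](\<lambda>z. z)) \<and>
     (\<exists>b. scalar_product b a = 0 \<and> Lm1 = outer a b - outer b a) \<and>
     (\<exists>k. L0 *v a = k *s a))"

text \<open>The expansion condition is imposed for every local coordinate at \<open>\<gamma> s\<close>; this is the same as
  imposing it for one. A change of coordinate rescales the residue \<open>L\<^sub>-\<^sub>1\<close> and adds a multiple of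
  it to \<open>L\<^sub>0\<close>, and \<open>L\<^sub>-\<^sub>1 \<alpha> = \<alpha> (\<beta>\<^sup>t \<alpha>) - \<beta> (\<alpha>\<^sup>t \<alpha>) = 0\<close>.\<close>

definition lax_operator ::
  "'a topology \<Rightarrow> 'a chart set \<Rightarrow> nat \<Rightarrow> 'a \<Rightarrow> 'a \<Rightarrow> (nat \<Rightarrow> complex^'n) \<Rightarrow> (nat \<Rightarrow> 'a)
     \<Rightarrow> ('a \<Rightarrow> complex^'n^'n) \<Rightarrow> bool" where
  "lax_operator X A g Pp Pm \<alpha> \<gamma> L \<longleftrightarrow>
     (let R = topspace X - ({Pp, Pm} \<union> \<gamma> ` {1..CARD('n) * g}) in
       (\<forall>x\<in>R. L x \<in> so_algebra) \<and>
       (\<forall>i j. meromorphic_on_surface A (\<lambda>x. L x $ i $ j) (topspace X) \<and>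
              holomorphic_on_surface A (\<lambda>x. L x $ i $ j) R) \<and>
       (\<forall>s\<in>{1..CARD('n) * g}. \<forall>c. local_coordinate_at X A (\<gamma> s) c \<longrightarrow>
              tyurin_expansion c (\<alpha> s) L))"

end

theory Submission
  imports Defs
begin

no_notation fps_nth (infixl "$" 75)

text \<open>Near \<open>\<gamma>\<^sub>s\<close> write \<open>L = a/z + b + c z + O(z\<^sup>2)\<close> and likewise for \<open>L'\<close>. Since \<open>\<alpha>\<close> is isotropic and
  orthogonal to \<open>\<beta>, \<beta>'\<close>, one has \<open>a a' = - (\<beta>\<^sup>t \<beta>') \<alpha> \<alpha>\<^sup>t\<close>, which is symmetric in the two operators, so
  the double pole of the bracket cancels. The residue \<open>[a, b'] + [b, a']\<close> is again of the
  form \<open>\<alpha> \<beta>\<^sup>t - \<beta> \<alpha>\<^sup>t\<close> because \<open>\<alpha>\<close> is an eigenvector of the skew matrices \<open>b, b'\<close>. In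
  \<open>([a, c'] + [b, b'] + [c, a']) \<alpha>\<close> the middle term vanishes and the outer ones are multiples
  of \<open>\<alpha>\<close>, because \<open>a \<alpha> = a' \<alpha> = 0\<close> and \<open>\<alpha>\<^sup>t c \<alpha> = \<alpha>\<^sup>t c' \<alpha> = 0\<close>; so the skewness of the linear
  coefficients is needed too.\<close>

section \<open>Matrix algebra\<close>

lemma matrix_diff_ldistrib: "A ** (B - C) = A ** B - A ** (C :: complex^'n^'m)"
  by (simp add: vec_eq_iff matrix_matrix_mult_def right_diff_distrib sum_subtractf)

lemma matrix_diff_rdistrib: "(A - B) ** C = A ** C - B ** (C :: complex^'n^'m)"
  by (simp add: vec_eq_iff matrix_matrix_mult_def left_diff_distrib sum_subtractf)

lemma so_algebra_nth: "M \<in> so_algebra \<longleftrightarrow> (\<forall>i j. M $ i $ j = - M $ j $ i)"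
  unfolding so_algebra_def transpose_def vec_eq_iff mem_Collect_eq vec_lambda_beta
    vector_uminus_component by (rule all_comm)

lemmas so_algebraD = so_algebra_nth[THEN iffD1, rule_format]
lemmas so_algebraI = so_algebra_nth[THEN iffD2, rule_format]

lemma so_algebra_add:
  assumes "M \<in> so_algebra" "N \<in> so_algebra"
  shows "M + N \<in> so_algebra"
proof (rule so_algebraI)
  fix i j
  show "(M + N) $ i $ j = - (M + N) $ j $ i"
    using assms[THEN so_algebraD, of i j] by simp
qed

lemma so_algebra_commutator:
  assumes "M \<in> so_algebra" "N \<in> so_algebra"
  shows "M ** N - N ** M \<in> so_algebra"
proof (rule so_algebraI)
  have *: "(\<Sum>k\<in>UNIV. M $ i $ k * N $ k $ j) = (\<Sum>k\<in>UNIV. N $ j $ k * M $ k $ i)" for i j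
  proof (rule sum.cong[OF refl])
    fix k
    show "M $ i $ k * N $ k $ j = N $ j $ k * M $ k $ i"
      using so_algebraD[OF assms(1), of i k] so_algebraD[OF assms(2), of k j] by simp
  qed
  show "(M ** N - N ** M) $ i $ j = - (M ** N - N ** M) $ j $ i" for i j
    by (simp add: matrix_matrix_mult_def *[of i j] *[of j i])
qed

lemma scalar_product_commute: "scalar_product x y = scalar_product y (x :: complex^'n)"
  by (simp add: scalar_product_def mult.commute)

lemma so_algebra_adjoint:
  assumes "M \<in> so_algebra"
  shows "scalar_product x (M *v y) = - scalar_product (M *v x) y"
proof -
  have "scalar_product x (M *v y) = (\<Sum>i\<in>UNIV. \<Sum>j\<in>UNIV. x $ i * (M $ i $ j * y $ j))"
    by (simp add: scalar_product_def matrix_vector_mult_def sum_distrib_left)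
  also have "\<dots> = (\<Sum>j\<in>UNIV. \<Sum>i\<in>UNIV. x $ i * (M $ i $ j * y $ j))"
    by (rule sum.swap)
  also have "\<dots> = (\<Sum>j\<in>UNIV. \<Sum>i\<in>UNIV. - (M $ j $ i * x $ i * y $ j))"
  proof (intro sum.cong refl)
    fix i j
    have "M $ i $ j = - M $ j $ i" using assms by (rule so_algebraD)
    then show "x $ i * (M $ i $ j * y $ j) = - (M $ j $ i * x $ i * y $ j)"
      by (simp add: algebra_simps)
  qed
  also have "\<dots> = - scalar_product (M *v x) y"
    by (simp add: scalar_product_def matrix_vector_mult_def sum_distrib_right sum_negf)
  finally show ?thesis .
qed

text \<open>The bilinear form is symmetric, so moving \<open>M\<close> across it turns this scalar
  into its own negative.\<close>

lemma so_algebra_isotropic: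
  assumes "M \<in> so_algebra"
  shows "scalar_product x (M *v x) = 0"
  using so_algebra_adjoint[OF assms, of x x] by (simp add: scalar_product_commute)

lemma outer_mult_vec: "outer x y *v v = scalar_product y v *s x"
  by (simp add: vec_eq_iff outer_def matrix_vector_mult_def scalar_product_def sum_distrib_right
      sum_distrib_left algebra_simps)

lemma outer_mult_outer: "outer x y ** outer u v = outer (scalar_product y u *s x) v"
  by (simp add: vec_eq_iff outer_def matrix_matrix_mult_def scalar_product_def sum_distrib_right
      sum_distrib_left algebra_simps)

lemma mat_mult_outer: "M ** outer x y = outer (M *v x) y"
  by (simp add: vec_eq_iff outer_def matrix_matrix_mult_def matrix_vector_mult_def
      sum_distrib_right sum_distrib_left algebra_simps)

text \<open>The row \<open>y\<^sup>t M\<close> is the transpose of \<open>M\<^sup>t y\<close>, and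
  skewness turns \<open>M\<^sup>t y\<close> into minus \<open>M *v y\<close>. This is the right-hand
  counterpart of \<open>mat_mult_outer\<close>.\<close>

lemma outer_mult_so_algebra:
  assumes "M \<in> so_algebra"
  shows "outer x y ** M = - outer x (M *v y)"
proof -
  have "(\<Sum>k\<in>UNIV. x $ i * y $ k * M $ k $ j) = - (x $ i * (\<Sum>k\<in>UNIV. M $ j $ k * y $ k))" for i j
  proof -
    have "x $ i * y $ k * M $ k $ j = - (x $ i * (M $ j $ k * y $ k))" for k
    proof -
      have "M $ k $ j = - M $ j $ k" using assms by (rule so_algebraD)
      then show ?thesis by simp
    qed
    then show ?thesis by (simp add: sum_distrib_left sum_negf)
  qed
  then show ?thesis
    by (simp add: vec_eq_iff outer_def matrix_matrix_mult_def matrix_vector_mult_def)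
qed

section \<open>Matrices of the shape required of residues\<close>

definition tyurin_residue :: "complex^'n \<Rightarrow> complex^'n \<Rightarrow> complex^'n^'n" where
  "tyurin_residue a b = outer a b - outer b a"

lemma tyurin_residue_so_algebra: "tyurin_residue a b \<in> so_algebra"
  by (rule so_algebraI) (simp add: tyurin_residue_def outer_def mult.commute)

lemma tyurin_residue_diff: "tyurin_residue a b - tyurin_residue a c = tyurin_residue a (b - c)"
  by (simp add: tyurin_residue_def outer_def vec_eq_iff algebra_simps)

lemma tyurin_residue_mult_vec:
  "tyurin_residue a b *v v = scalar_product b v *s a - scalar_product a v *s b"
  by (simp add: tyurin_residue_def matrix_vector_mult_diff_rdistrib outer_mult_vec)

text \<open>Of the four rank-one terms of the product, three carry a factor
  \<open>a\<^sup>t a\<close>, \<open>b\<^sup>t a\<close> or \<open>a\<^sup>t c\<close> and vanish.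
  What is left, \<open>- (b\<^sup>t c) a a\<^sup>t\<close>, is symmetric in \<open>b\<close> and
  \<open>c\<close>.\<close>

lemma tyurin_residues_commute:
  assumes "scalar_product a a = 0" "scalar_product b a = 0" "scalar_product c a = 0"
  shows "tyurin_residue a b ** tyurin_residue a c = tyurin_residue a c ** tyurin_residue a b"
proof -
  have *: "tyurin_residue a b ** tyurin_residue a c = outer (- scalar_product b c *s a) a"
    if "scalar_product b a = 0" "scalar_product c a = 0" for b c
    using that assms(1) scalar_product_commute[of a c]
    by (simp add: tyurin_residue_def matrix_diff_ldistrib matrix_diff_rdistrib outer_mult_outer)
      (simp add: outer_def vec_eq_iff)
  show ?thesis
    using assms by (simp add: * scalar_product_commute[of c b])
qed

text \<open>The bracket consists of the four outer products \<open>- a (M b)\<^sup>t\<close>,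
  \<open>b (M a)\<^sup>t\<close>, \<open>- (M a) b\<^sup>t\<close> and
  \<open>(M b) a\<^sup>t\<close>. Replacing \<open>M a\<close> by \<open>k a\<close> leaves a factor
  \<open>a\<close> in each of them. In the application \<open>M\<close> is the constant coefficient
  of the other operator.\<close>

lemma tyurin_residue_commutator:
  assumes "M \<in> so_algebra" "M *v a = k *s a"
  shows "tyurin_residue a b ** M - M ** tyurin_residue a b =
           - tyurin_residue a (M *v b + k *s b)"
  using assms
  by (simp add: tyurin_residue_def matrix_diff_ldistrib matrix_diff_rdistrib mat_mult_outer
      outer_mult_so_algebra) (simp add: vec_eq_iff outer_def algebra_simps)

text \<open>The residue matrix kills \<open>a\<close>, so only its action on \<open>M *v a\<close>
  survives, and there the component along \<open>b\<close> has the factor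
  \<open>a\<^sup>t M a = 0\<close>. In the application \<open>M\<close> is a linear coefficient,
  which is known to be skew but need not have \<open>a\<close> as an eigenvector.\<close>

lemma tyurin_residue_commutator_mult_vec:
  assumes "M \<in> so_algebra" "scalar_product a a = 0" "scalar_product b a = 0"
  shows "(tyurin_residue a b ** M - M ** tyurin_residue a b) *v a = scalar_product b (M *v a) *s a"
  using assms
  by (simp add: matrix_vector_mult_diff_rdistrib tyurin_residue_mult_vec so_algebra_isotropic
      flip: matrix_vector_mul_assoc)

section \<open>Local expansions\<close>

text \<open>A simple pole in one factor lifts the linear term of the other into the constant term of
  a product, so a remainder \<open>O(z)\<close> is too coarse. Holomorphy off 0 refines it: the
  remainder divided by \<open>z\<close> is bounded near 0, hence extends holomorphically by
  Riemann's removable singularity theorem.\<close>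

lemma expansion_linear_term:
  fixes f :: "complex \<Rightarrow> complex"
  assumes "open T" "0 \<in> T" and hol: "f holomorphic_on T - {0}"
    and big: "(\<lambda>z. f z - (a / z + b)) \<in> O[at 0](\<lambda>z. z)"
  shows "\<exists>c. (\<lambda>z. f z - (a / z + b + c * z)) \<in> O[at 0](\<lambda>z. z ^ 2)"
proof -
  define h where "h z = (f z - (a / z + b)) / z" for z
  have "h holomorphic_on T - {0}"
    unfolding h_def by (intro holomorphic_intros hol) auto
  moreover obtain B where "eventually (\<lambda>z. norm (f z - (a / z + b)) \<le> B * norm z) (at 0)"
    using big by (auto elim: landau_o.bigE)
  then have "eventually (\<lambda>z. norm (h z) \<le> B) (at 0)"
    using eventually_neq_at_within[of 0 0 UNIV]
    by eventually_elim (simp add: h_def norm_divide pos_divide_le_eq)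
  ultimately obtain G where G: "G holomorphic_on T" "\<forall>z\<in>T - {0}. G z = h z"
    using holomorphic_on_extend_bounded[of h T 0] assms(1,2) by (auto simp: interior_open)
  \<comment> \<open>The coefficient sought is \<open>G 0\<close>: differentiability makes
    \<open>G z - G 0\<close> of order \<open>z\<close>, and multiplying back by \<open>z\<close>
    gives order \<open>z ^ 2\<close>.\<close>
  have "G field_differentiable at 0"
    using G(1) assms(1,2) by (simp add: holomorphic_on_imp_differentiable_at)
  then obtain D where "((\<lambda>z. (G z - G 0) / (z - 0)) \<longlongrightarrow> D) (at 0)"
    unfolding field_differentiable_def has_field_derivative_iff by auto
  then have "(\<lambda>z. G z - G 0) \<in> O[at 0](\<lambda>z. z)"
    by (intro bigoI_tendsto[of _ _ D]) (auto simp: eventually_at_filter)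
  then have "(\<lambda>z. (G z - G 0) * z) \<in> O[at 0](\<lambda>z. z * z)"
    by (intro landau_o.big.mult) auto
  also have "?this \<longleftrightarrow> (\<lambda>z. f z - (a / z + b + G 0 * z)) \<in> O[at 0](\<lambda>z. z * z)"
  proof (intro landau_o.big.in_cong)
    have "eventually (\<lambda>z. z \<in> T - {0}) (at 0)"
      using assms(1,2) by (rule eventually_at_in_open)
    then show "eventually (\<lambda>z. (G z - G 0) * z = f z - (a / z + b + G 0 * z)) (at 0)"
      by eventually_elim (use G in \<open>simp add: h_def field_simps\<close>)
  qed
  finally show ?thesis by (auto simp: power2_eq_square)
qed

text \<open>Antisymmetrising the linear coefficient does not affect the expansion, so it may be taken
  skew without appealing to uniqueness.\<close>

lemma so_expansion_linear_term:
  fixes M :: "complex \<Rightarrow> complex^'n^'n"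
  assumes "open T" "0 \<in> T" "\<And>i j. (\<lambda>z. M z $ i $ j) holomorphic_on T - {0}"
    and skew: "\<And>z. z \<in> T - {0} \<Longrightarrow> M z \<in> so_algebra" "a \<in> so_algebra" "b \<in> so_algebra"
    and "\<And>i j. (\<lambda>z. M z $ i $ j - (a $ i $ j / z + b $ i $ j)) \<in> O[at 0](\<lambda>z. z)"
  shows "\<exists>c\<in>so_algebra. \<forall>i j.
    (\<lambda>z. M z $ i $ j - (a $ i $ j / z + b $ i $ j + c $ i $ j * z)) \<in> O[at 0](\<lambda>z. z ^ 2)"
proof -
  have "\<exists>c. (\<lambda>z. M z $ i $ j - (a $ i $ j / z + b $ i $ j + c * z)) \<in> O[at 0](\<lambda>z. z ^ 2)" for i j
    by (rule expansion_linear_term[OF assms(1,2,3,7)])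
  then have "\<forall>i j. \<exists>c. (\<lambda>z. M z $ i $ j - (a $ i $ j / z + b $ i $ j + c * z)) \<in> O[at 0](\<lambda>z. z ^ 2)"
    by blast
  then obtain C where
    C: "\<And>i j. (\<lambda>z. M z $ i $ j - (a $ i $ j / z + b $ i $ j + C i j * z)) \<in> O[at 0](\<lambda>z. z ^ 2)"
    unfolding choice_iff by blast
  define c :: "complex^'n^'n" where "c = (\<chi> i j. (C i j - C j i) / 2)"
  have "c \<in> so_algebra"
    by (rule so_algebraI) (simp add: c_def minus_divide_left)
  moreover have "(\<lambda>z. M z $ i $ j - (a $ i $ j / z + b $ i $ j + c $ i $ j * z)) \<in> O[at 0](\<lambda>z. z ^ 2)"
    for i j
  proof -
    \<comment> \<open>Half the difference of the remainders at \<open>(i, j)\<close> and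
      \<open>(j, i)\<close>. Near 0 it equals the remainder formed with \<open>c\<close>, since
      \<open>M z\<close>, \<open>a\<close> and \<open>b\<close> change sign under
      transposition.\<close>
    have "(\<lambda>z. 1/2 * ((M z $ i $ j - (a $ i $ j / z + b $ i $ j + C i j * z)) -
             (M z $ j $ i - (a $ j $ i / z + b $ j $ i + C j i * z)))) \<in> O[at 0](\<lambda>z. z ^ 2)"
      by (subst landau_o.big.cmult_in_iff) (simp, intro sum_in_bigo C)
    also have "?this \<longleftrightarrow> ?thesis"
    proof (intro landau_o.big.in_cong)
      have ab: "a $ j $ i = - a $ i $ j" "b $ j $ i = - b $ i $ j"
        using skew(2,3) by (auto intro: so_algebraD)
      have "eventually (\<lambda>z. z \<in> T - {0}) (at 0)"
        using assms(1,2) by (rule eventually_at_in_open)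
      then show "eventually (\<lambda>z. 1/2 * ((M z $ i $ j - (a $ i $ j / z + b $ i $ j + C i j * z)) -
             (M z $ j $ i - (a $ j $ i / z + b $ j $ i + C j i * z))) =
             M z $ i $ j - (a $ i $ j / z + b $ i $ j + c $ i $ j * z)) (at 0)"
      proof eventually_elim
        case (elim z)
        then have "M z $ j $ i = - M z $ i $ j"
          by (intro so_algebraD skew(1))
        with elim show ?case by (simp add: ab c_def field_simps)
      qed
    qed
    finally show ?thesis .
  qed
  ultimately show ?thesis by blast
qed

text \<open>An error of order \<open>z ^ 2\<close> times a factor of order \<open>1 / z\<close> is
  still \<open>O(z)\<close>, so expansions up to the linear term determine the product up to its
  constant term.\<close>

lemma expansion_mult:
  fixes f h :: "complex \<Rightarrow> complex"
  assumes f: "(\<lambda>z. f z - (a / z + b + c * z)) \<in> O[at 0](\<lambda>z. z ^ 2)"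
    and h: "(\<lambda>z. h z - (a' / z + b' + c' * z)) \<in> O[at 0](\<lambda>z. z ^ 2)"
  shows "(\<lambda>z. f z * h z - (a * a' / z ^ 2 + (a * b' + b * a') / z + (a * c' + b * b' + c * a')))
           \<in> O[at 0](\<lambda>z. z)"
proof -
  define r where "r z = f z - (a / z + b + c * z)" for z
  define r' where "r' z = h z - (a' / z + b' + c' * z)" for z
  have small: "(\<lambda>z::complex. x) \<in> O[at 0](\<lambda>z. 1 / z)" "(\<lambda>z::complex. x * z) \<in> O[at 0](\<lambda>z. 1 / z)"
    "(\<lambda>z::complex. z ^ 2) \<in> O[at 0](\<lambda>z. 1 / z)" "(\<lambda>z::complex. z ^ 2) \<in> O[at 0](\<lambda>z. z)"
    for x :: complex
  proof -
    have nz: "eventually (\<lambda>z::complex. z \<noteq> 0) (at 0)" by (rule eventually_neq_at_within)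
    show "(\<lambda>z::complex. x) \<in> O[at 0](\<lambda>z. 1 / z)"
      by (rule bigoI_tendsto[of _ _ 0]) (auto intro!: tendsto_eq_intros simp: eventually_at_filter)
    show "(\<lambda>z::complex. x * z) \<in> O[at 0](\<lambda>z. 1 / z)"
      by (rule bigoI_tendsto[of _ _ 0]) (auto intro!: tendsto_eq_intros simp: eventually_at_filter)
    show "(\<lambda>z::complex. z ^ 2) \<in> O[at 0](\<lambda>z. 1 / z)"
      by (rule bigoI_tendsto[of _ _ 0]) (auto intro!: tendsto_eq_intros simp: eventually_at_filter)
    show "(\<lambda>z::complex. z ^ 2) \<in> O[at 0](\<lambda>z. z)"
      using tendsto_ident_at[of "0::complex" UNIV]
      by (intro bigoI_tendsto[of _ _ 0]) (simp_all add: power2_eq_square nz)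
  qed
  have polar: "(\<lambda>z. x / z + y + w * z) \<in> O[at 0](\<lambda>z. 1 / z)" for x y w :: complex
    by (intro sum_in_bigo small) (simp add: landau_o.big.cmult_in_iff divide_inverse)
  have r: "r \<in> O[at 0](\<lambda>z. z ^ 2)" and r': "r' \<in> O[at 0](\<lambda>z. z ^ 2)"
    using f h by (simp_all add: r_def[abs_def] r'_def[abs_def])
  have error: "(\<lambda>z. p z * q z) \<in> O[at 0](\<lambda>z. z)"
    if "p \<in> O[at 0](\<lambda>z. z ^ 2)" "q \<in> O[at 0](\<lambda>z. 1 / z)" for p q :: "complex \<Rightarrow> complex"
    using landau_o.big.mult[OF that] by (simp add: power2_eq_square)
  \<comment> \<open>These five terms are exactly what remains of the expanded product once the
    coefficients of \<open>1 / z ^ 2\<close>, \<open>1 / z\<close> and 1 are removed.\<close>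
  have "(\<lambda>z. (b * c' + c * b') * z + (c * c') * z ^ 2 + r z * (a' / z + b' + c' * z) +
           r' z * (a / z + b + c * z) + r z * r' z) \<in> O[at 0](\<lambda>z. z)"
  proof (intro sum_in_bigo(1) error[OF r polar] error[OF r' polar])
    show "(\<lambda>z. (b * c' + c * b') * z) \<in> O[at 0](\<lambda>z. z)"
      by simp
    show "(\<lambda>z. (c * c') * z ^ 2) \<in> O[at 0](\<lambda>z. z)"
      using small(4) by (simp add: landau_o.big.cmult_in_iff)
    show "(\<lambda>z. r z * r' z) \<in> O[at 0](\<lambda>z. z)"
      by (rule error[OF r landau_o.big_trans[OF r' small(3)]])
  qed
  also have "?this \<longleftrightarrow> ?thesis"
  proof (intro landau_o.big.in_cong)
    show "eventually (\<lambda>z. (b * c' + c * b') * z + (c * c') * z ^ 2 +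
        r z * (a' / z + b' + c' * z) + r' z * (a / z + b + c * z) + r z * r' z =
        f z * h z - (a * a' / z ^ 2 + (a * b' + b * a') / z + (a * c' + b * b' + c * a'))) (at 0)"
      using eventually_neq_at_within[of 0 0 UNIV]
    proof eventually_elim
      case (elim z)
      have f: "f z = a / z + b + c * z + r z" and h: "h z = a' / z + b' + c' * z + r' z"
        by (simp_all add: r_def r'_def)
      show ?case unfolding f h using elim by (simp add: field_simps power2_eq_square)
    qed
  qed
  finally show ?thesis .
qed

lemma matrix_expansion_mult:
  fixes M N :: "complex \<Rightarrow> complex^'n^'n"
  assumes "\<And>i j. (\<lambda>z. M z $ i $ j - (a $ i $ j / z + b $ i $ j + c $ i $ j * z)) \<in> O[at 0](\<lambda>z. z ^ 2)"
    and "\<And>i j. (\<lambda>z. N z $ i $ j - (a' $ i $ j / z + b' $ i $ j + c' $ i $ j * z)) \<in> O[at 0](\<lambda>z. z ^ 2)"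
  shows "(\<lambda>z. (M z ** N z) $ i $ j - ((a ** a') $ i $ j / z ^ 2 + (a ** b' + b ** a') $ i $ j / z +
           (a ** c' + b ** b' + c ** a') $ i $ j)) \<in> O[at 0](\<lambda>z. z)"
proof -
  have "(\<lambda>z. \<Sum>k\<in>UNIV. M z $ i $ k * N z $ k $ j - (a $ i $ k * a' $ k $ j / z ^ 2 +
          (a $ i $ k * b' $ k $ j + b $ i $ k * a' $ k $ j) / z +
          (a $ i $ k * c' $ k $ j + b $ i $ k * b' $ k $ j + c $ i $ k * a' $ k $ j)))
         \<in> O[at 0](\<lambda>z. z)"
    by (intro big_sum_in_bigo expansion_mult assms)
  then show ?thesis
    by (simp add: matrix_matrix_mult_def sum_subtractf sum.distrib sum_divide_distrib
        add_divide_distrib)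
qed

text \<open>\<open>comm\<close> cancels the double pole. The other brackets are grouped so that
  those involving a residue have it as first entry, the form in which the facts about
  \<open>tyurin_residue\<close> apply.\<close>

lemma matrix_expansion_commutator:
  fixes M N :: "complex \<Rightarrow> complex^'n^'n"
  assumes "\<And>i j. (\<lambda>z. M z $ i $ j - (a $ i $ j / z + b $ i $ j + c $ i $ j * z)) \<in> O[at 0](\<lambda>z. z ^ 2)"
    and "\<And>i j. (\<lambda>z. N z $ i $ j - (a' $ i $ j / z + b' $ i $ j + c' $ i $ j * z)) \<in> O[at 0](\<lambda>z. z ^ 2)"
    and comm: "a ** a' = a' ** a"
  shows "(\<lambda>z. (M z ** N z - N z ** M z) $ i $ j -
     (((a ** b' - b' ** a) - (a' ** b - b ** a')) $ i $ j / z +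
      ((a ** c' - c' ** a) + (b ** b' - b' ** b) - (a' ** c - c ** a')) $ i $ j)) \<in> O[at 0](\<lambda>z. z)"
proof -
  have "(M z ** N z - N z ** M z) $ i $ j -
     (((a ** b' - b' ** a) - (a' ** b - b ** a')) $ i $ j / z +
      ((a ** c' - c' ** a) + (b ** b' - b' ** b) - (a' ** c - c ** a')) $ i $ j) =
     (M z ** N z) $ i $ j - ((a ** a') $ i $ j / z ^ 2 + (a ** b' + b ** a') $ i $ j / z +
        (a ** c' + b ** b' + c ** a') $ i $ j) -
     ((N z ** M z) $ i $ j - ((a' ** a) $ i $ j / z ^ 2 + (a' ** b + b' ** a) $ i $ j / z +
        (a' ** c + b' ** b + c' ** a) $ i $ j))" for z
    by (simp add: comm diff_divide_distrib add_divide_distrib)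
  then show ?thesis
    by (simp only:) (intro sum_in_bigo(2) matrix_expansion_mult assms(1,2))
qed

section \<open>Local coordinates\<close>

lemma complex_chart_open_image:
  assumes "complex_chart X (U, \<phi>)" "openin X W"
  shows "open (\<phi> ` (U \<inter> W))"
proof -
  have hm: "homeomorphic_map (subtopology X U) (top_of_set (\<phi> ` U)) \<phi>" and op: "open (\<phi> ` U)"
    using assms by (auto simp: complex_chart_def)
  have "openin (subtopology X U) (U \<inter> W)"
    using assms(2) by (simp add: openin_subtopology_Int2)
  then have "openin (top_of_set (\<phi> ` U)) (\<phi> ` (U \<inter> W))"
    using homeomorphic_imp_open_map[OF hm] by (simp add: open_map_def)
  then show ?thesis using op openin_open_trans by blast
qed

lemma complex_chart_inj_on:
  assumes "complex_chart X (U, \<phi>)"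
  shows "inj_on \<phi> U"
proof -
  have "homeomorphic_map (subtopology X U) (top_of_set (\<phi> ` U)) \<phi>" "U \<subseteq> topspace X"
    using assms by (auto simp: complex_chart_def openin_subset)
  then show ?thesis
    using homeomorphic_imp_injective_map by (fastforce simp: inf_absorb2)
qed

text \<open>Holomorphy on the surface is tested only in charts of \<open>A\<close>, whereas a local
  coordinate is merely compatible with them. Near each point the map factors through a chart of
  \<open>A\<close> and a transition map, which is holomorphic by compatibility.\<close>

lemma holomorphic_on_surface_compatible_chart:
  assumes "riemann_surface X A" "complex_chart X (U, \<phi>)" "\<forall>d\<in>A. compatible_charts (U, \<phi>) d"
    and hol: "holomorphic_on_surface A f S" and "openin X S"
  shows "(f \<circ> inv_into U \<phi>) holomorphic_on \<phi> ` (U \<inter> S)"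
proof -
  have inj: "inj_on \<phi> U" using assms(2) by (rule complex_chart_inj_on)
  have "(f \<circ> inv_into U \<phi>) field_differentiable at (\<phi> x)" if x: "x \<in> U" "x \<in> S" for x
  proof -
    have "x \<in> topspace X" using x(2) assms(5) openin_subset by blast
    then obtain d where "d \<in> A" "x \<in> fst d" using assms(1) unfolding riemann_surface_def by blast
    then obtain V \<psi> where d: "(V, \<psi>) \<in> A" "x \<in> V" by (cases d) auto
    then have ch: "complex_chart X (V, \<psi>)" using assms(1) by (auto simp: riemann_surface_def)
    have injV: "inj_on \<psi> V" using ch by (rule complex_chart_inj_on)
    let ?W = "\<phi> ` (U \<inter> (V \<inter> S))"
    have "openin X (V \<inter> S)" using ch assms(5) by (auto simp: complex_chart_def)
    then have opn: "open ?W" by (rule complex_chart_open_image[OF assms(2)])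
    have "(\<psi> \<circ> inv_into U \<phi>) holomorphic_on \<phi> ` (U \<inter> V)"
      using assms(3) d(1) by (auto simp: compatible_charts_def)
    then have tr: "(\<psi> \<circ> inv_into U \<phi>) holomorphic_on ?W"
      by (rule holomorphic_on_subset) auto
    have "(f \<circ> inv_into V \<psi>) holomorphic_on \<psi> ` (V \<inter> S)"
      using hol d(1) by (auto simp: holomorphic_on_surface_def)
    then have "(f \<circ> inv_into V \<psi>) \<circ> (\<psi> \<circ> inv_into U \<phi>) holomorphic_on ?W"
      by (rule holomorphic_on_compose_gen[OF tr]) (auto simp: inj)
    moreover have "((f \<circ> inv_into V \<psi>) \<circ> (\<psi> \<circ> inv_into U \<phi>)) z = (f \<circ> inv_into U \<phi>) z"
      if "z \<in> ?W" for z
      using that inj injV by auto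
    ultimately have "(f \<circ> inv_into U \<phi>) holomorphic_on ?W"
      by (rule holomorphic_transform)
    then show ?thesis
      using opn x d(2) by (intro holomorphic_on_imp_differentiable_at[of _ ?W]) auto
  qed
  then show ?thesis
    unfolding holomorphic_on_def
    by (blast intro: field_differentiable_at_within)
qed

text \<open>The local form of the result at one Tyurin point: \<open>T\<close> is a neighbourhood of
  0 in the coordinate plane whose other points are regular for both operators.\<close>

lemma tyurin_expansion_commutator:
  fixes L L' :: "'a \<Rightarrow> complex^'n^'n"
  assumes "open T" "0 \<in> T" and iso: "scalar_product a a = 0"
    and L: "tyurin_expansion (U, \<phi>) a L"
      "\<And>i j. (\<lambda>z. L (inv_into U \<phi> z) $ i $ j) holomorphic_on T - {0}"
      "\<And>z. z \<in> T - {0} \<Longrightarrow> L (inv_into U \<phi> z) \<in> so_algebra"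
    and L': "tyurin_expansion (U, \<phi>) a L'"
      "\<And>i j. (\<lambda>z. L' (inv_into U \<phi> z) $ i $ j) holomorphic_on T - {0}"
      "\<And>z. z \<in> T - {0} \<Longrightarrow> L' (inv_into U \<phi> z) \<in> so_algebra"
  shows "tyurin_expansion (U, \<phi>) a (\<lambda>x. L x ** L' x - L' x ** L x)"
proof -
  \<comment> \<open>Both operators need the same refinement of \<open>tyurin_expansion\<close> by a
    skew linear coefficient \<open>L1\<close>.\<close>
  have expansion: "\<exists>b k L0 L1. L0 \<in> so_algebra \<and> L1 \<in> so_algebra \<and> scalar_product b a = 0 \<and>
      L0 *v a = k *s a \<and>
      (\<forall>i j. (\<lambda>z. K (inv_into U \<phi> z) $ i $ j - (tyurin_residue a b $ i $ j / z + L0 $ i $ j +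
         L1 $ i $ j * z)) \<in> O[at 0](\<lambda>z. z ^ 2))"
    if K: "tyurin_expansion (U, \<phi>) a K"
      "\<And>i j. (\<lambda>z. K (inv_into U \<phi> z) $ i $ j) holomorphic_on T - {0}"
      "\<And>z. z \<in> T - {0} \<Longrightarrow> K (inv_into U \<phi> z) \<in> so_algebra"
    for K :: "'a \<Rightarrow> complex^'n^'n"
  proof -
    obtain L0 b k where 1: "L0 \<in> so_algebra" "scalar_product b a = 0" "L0 *v a = k *s a"
      and 2: "\<And>i j. (\<lambda>z. K (inv_into U \<phi> z) $ i $ j - (tyurin_residue a b $ i $ j / z + L0 $ i $ j))
              \<in> O[at 0](\<lambda>z. z)"
      using K(1) unfolding tyurin_expansion_def tyurin_residue_def prod.case by blast
    have "\<exists>c\<in>so_algebra. \<forall>i j. (\<lambda>z. K (inv_into U \<phi> z) $ i $ j -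
        (tyurin_residue a b $ i $ j / z + L0 $ i $ j + c $ i $ j * z)) \<in> O[at 0](\<lambda>z. z ^ 2)"
      by (intro so_expansion_linear_term[OF assms(1,2)] K tyurin_residue_so_algebra 1 2)
    then show ?thesis using 1 by blast
  qed
  obtain b k L0 L1 where 1: "L0 \<in> so_algebra" "L1 \<in> so_algebra" "scalar_product b a = 0"
      "L0 *v a = k *s a"
    and e1: "\<And>i j. (\<lambda>z. L (inv_into U \<phi> z) $ i $ j - (tyurin_residue a b $ i $ j / z + L0 $ i $ j +
         L1 $ i $ j * z)) \<in> O[at 0](\<lambda>z. z ^ 2)"
    using expansion[OF L] by blast
  obtain b' k' L0' L1' where 2: "L0' \<in> so_algebra" "L1' \<in> so_algebra" "scalar_product b' a = 0"
      "L0' *v a = k' *s a"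
    and e2: "\<And>i j. (\<lambda>z. L' (inv_into U \<phi> z) $ i $ j - (tyurin_residue a b' $ i $ j / z + L0' $ i $ j +
         L1' $ i $ j * z)) \<in> O[at 0](\<lambda>z. z ^ 2)"
    using expansion[OF L'] by blast
  let ?R = "tyurin_residue a b" and ?R' = "tyurin_residue a b'"
  define Km1 where "Km1 = (?R ** L0' - L0' ** ?R) - (?R' ** L0 - L0 ** ?R')"
  define K0 where "K0 = (?R ** L1' - L1' ** ?R) + (L0 ** L0' - L0' ** L0) - (?R' ** L1 - L1 ** ?R')"
  \<comment> \<open>By \<open>tyurin_residue_commutator\<close> the two brackets in
    \<open>Km1\<close> are minus the residue matrices of \<open>L0' *v b + k' *s b\<close> and of
    \<open>L0 *v b' + k *s b'\<close>. Linearity in the second argument then yields this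
    vector.\<close>
  define \<beta> where "\<beta> = (L0 *v b' + k *s b') - (L0' *v b + k' *s b)"
  have exp: "(\<lambda>z. (L (inv_into U \<phi> z) ** L' (inv_into U \<phi> z) - L' (inv_into U \<phi> z) ** L (inv_into U \<phi> z))
      $ i $ j - (Km1 $ i $ j / z + K0 $ i $ j)) \<in> O[at 0](\<lambda>z. z)" for i j
    unfolding Km1_def K0_def
    by (rule matrix_expansion_commutator[OF e1 e2 tyurin_residues_commute[OF iso 1(3) 2(3)]])
  have Km1: "Km1 = tyurin_residue a \<beta>"
    by (simp add: Km1_def \<beta>_def tyurin_residue_commutator[OF 2(1,4)]
        tyurin_residue_commutator[OF 1(1,4)] flip: tyurin_residue_diff)
  \<comment> \<open>Skewness gives
    \<open>(M v)\<^sup>t a = - v\<^sup>t (M a) = - l (v\<^sup>t a) = 0\<close>. It is applied to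
    each half of \<open>\<beta>\<close>.\<close>
  have orth: "scalar_product (M *v v + l *s v) a = 0"
    if "M \<in> so_algebra" "M *v a = l *s a" "scalar_product v a = 0" for M v l
  proof -
    have "scalar_product v (M *v a) = 0"
      using that(2,3) by (simp add: scalar_product_def mult.left_commute flip: sum_distrib_left)
    then have "scalar_product (M *v v) a = 0"
      using so_algebra_adjoint[OF that(1), of v a] by simp
    with that(3) show ?thesis
      by (simp add: scalar_product_def distrib_right sum.distrib mult.assoc flip: sum_distrib_left)
  qed
  have \<beta>: "scalar_product \<beta> a = 0"
    using orth[OF 1(1,4) 2(3)] orth[OF 2(1,4) 1(3)]
    by (simp add: \<beta>_def scalar_product_def left_diff_distrib sum_subtractf)
  \<comment> \<open>Both products multiply the common eigenvector \<open>a\<close> by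
    \<open>k * k'\<close>.\<close>
  have "(L0 ** L0' - L0' ** L0) *v a = 0"
    using 1(4) 2(4)
    by (simp add: matrix_vector_mult_diff_rdistrib vector_scalar_commute vector_smult_assoc
        mult.commute flip: matrix_vector_mul_assoc)
  \<comment> \<open>The new eigenvalue comes entirely from the two brackets of a residue with a
    linear coefficient.\<close>
  then have "K0 *v a = (scalar_product b (L1' *v a) - scalar_product b' (L1 *v a)) *s a"
    by (simp add: K0_def matrix_vector_mult_diff_rdistrib[of "_ + _"]
        matrix_vector_mult_add_rdistrib tyurin_residue_commutator_mult_vec 1 2 iso
        vector_sub_rdistrib)
  moreover have "K0 \<in> so_algebra"
  proof -
    \<comment> \<open>Reversing the last bracket absorbs its sign and makes \<open>K0\<close> a sum
      of commutators of skew matrices.\<close>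
    have "K0 = (?R ** L1' - L1' ** ?R) + (L0 ** L0' - L0' ** L0) + (L1 ** ?R' - ?R' ** L1)"
      by (simp add: K0_def)
    then show ?thesis
      by (simp add: so_algebra_add so_algebra_commutator tyurin_residue_so_algebra 1 2)
  qed
  moreover have "Km1 \<in> so_algebra" by (simp add: Km1 tyurin_residue_so_algebra)
  ultimately show ?thesis
    unfolding tyurin_expansion_def prod.case using exp Km1 \<beta>
    unfolding tyurin_residue_def by blast
qed

section \<open>The commutator on the whole surface\<close>

theorem lemma2p2:
  fixes X :: "'a topology" and A :: "'a chart set" and g :: nat
    and Pp Pm :: 'a
    and \<alpha> :: "nat \<Rightarrow> complex^'n" and \<gamma> :: "nat \<Rightarrow> 'a"
    and L L' :: "'a \<Rightarrow> complex^'n^'n"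
  assumes "compact_riemann_surface X A g"
    and "Pp \<in> topspace X" and "Pm \<in> topspace X" and "Pp \<noteq> Pm"
    and "tyurin_parameters X g Pp Pm \<alpha> \<gamma>"
    and "lax_operator X A g Pp Pm \<alpha> \<gamma> L"
    and "lax_operator X A g Pp Pm \<alpha> \<gamma> L'"
  shows "lax_operator X A g Pp Pm \<alpha> \<gamma> (\<lambda>x. L x ** L' x - L' x ** L x)"
proof -
  define P where "P = {Pp, Pm} \<union> \<gamma> ` {1..CARD('n) * g}"
  define R where "R = topspace X - P"
  have rs: "riemann_surface X A" using assms(1) by (simp add: compact_riemann_surface_def)
  \<comment> \<open>Finite sets are closed in a Hausdorff space. Two cases are used:
    \<open>F = P\<close> for the regular set \<open>R\<close>, and
    \<open>F = P - {\<gamma> s}\<close> for a neighbourhood of \<open>\<gamma> s\<close>.\<close>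
  have op: "openin X (topspace X - F)" if "F \<subseteq> P" for F
  proof -
    have "finite F" using that finite_subset by (fastforce simp: P_def)
    moreover have "t1_space X"
      using rs Hausdorff_imp_t1_space by (auto simp: riemann_surface_def)
    ultimately have "closedin X (topspace X \<inter> F)"
      by (simp add: t1_space_closedin_finite)
    moreover have "topspace X - F = topspace X - topspace X \<inter> F" by blast
    ultimately show ?thesis by (metis openin_diff openin_topspace)
  qed
  have lax: "(\<forall>x\<in>R. K x \<in> so_algebra) \<and>
       (\<forall>i j. meromorphic_on_surface A (\<lambda>x. K x $ i $ j) (topspace X) \<and>
              holomorphic_on_surface A (\<lambda>x. K x $ i $ j) R) \<and>
       (\<forall>s\<in>{1..CARD('n) * g}. \<forall>c. local_coordinate_at X A (\<gamma> s) c \<longrightarrow>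
              tyurin_expansion c (\<alpha> s) K) \<longleftrightarrow> lax_operator X A g Pp Pm \<alpha> \<gamma> K" for K
    by (simp add: lax_operator_def R_def P_def Let_def)
  note L = assms(6)[folded lax] and L' = assms(7)[folded lax]
  show ?thesis
    unfolding lax[symmetric]
  proof (intro conjI ballI allI impI)
    fix x assume "x \<in> R"
    then show "L x ** L' x - L' x ** L x \<in> so_algebra"
      using L L' by (simp add: so_algebra_commutator)
  next
    fix i j
    have "((\<lambda>x. L x $ i $ j) \<circ> inv_into U \<phi>) meromorphic_on \<phi> ` (U \<inter> topspace X)"
      "((\<lambda>x. L' x $ i $ j) \<circ> inv_into U \<phi>) meromorphic_on \<phi> ` (U \<inter> topspace X)"
      if "(U, \<phi>) \<in> A" for U \<phi> i j
      using that L L' by (fastforce simp: meromorphic_on_surface_def)+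
    then show "meromorphic_on_surface A (\<lambda>x. (L x ** L' x - L' x ** L x) $ i $ j) (topspace X)"
      by (auto simp: meromorphic_on_surface_def matrix_matrix_mult_def o_def
          intro!: meromorphic_intros)
  next
    fix i j
    have "((\<lambda>x. L x $ i $ j) \<circ> inv_into U \<phi>) holomorphic_on \<phi> ` (U \<inter> R)"
      "((\<lambda>x. L' x $ i $ j) \<circ> inv_into U \<phi>) holomorphic_on \<phi> ` (U \<inter> R)"
      if "(U, \<phi>) \<in> A" for U \<phi> i j
      using that L L' by (fastforce simp: holomorphic_on_surface_def)+
    then show "holomorphic_on_surface A (\<lambda>x. (L x ** L' x - L' x ** L x) $ i $ j) R"
      by (auto simp: holomorphic_on_surface_def matrix_matrix_mult_def o_def
          intro!: holomorphic_intros)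
  next
    fix s c assume s: "s \<in> {1..CARD('n) * g}" and c: "local_coordinate_at X A (\<gamma> s) c"
    obtain U \<phi> where [simp]: "c = (U, \<phi>)" by (cases c)
    have ch: "complex_chart X (U, \<phi>)" "\<forall>d\<in>A. compatible_charts (U, \<phi>) d"
      and p: "\<gamma> s \<in> U" "\<phi> (\<gamma> s) = 0"
      using c by (auto simp: local_coordinate_at_def)
    have inj: "inj_on \<phi> U" using ch(1) by (rule complex_chart_inj_on)
    have "U \<subseteq> topspace X" using ch(1) by (simp add: complex_chart_def openin_subset)
    moreover have "\<gamma> s \<in> P" using s by (simp add: P_def)
    ultimately have UR: "U \<inter> (topspace X - (P - {\<gamma> s})) = insert (\<gamma> s) (U \<inter> R)" "\<gamma> s \<notin> R"
      using p by (auto simp: R_def)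
    \<comment> \<open>Only the other marked points are removed, so \<open>T\<close> is open,
      contains \<open>0 = \<phi> (\<gamma> s)\<close>, and loses just the image of
      \<open>\<gamma> s\<close> when punctured at 0.\<close>
    define T where "T = \<phi> ` (U \<inter> (topspace X - (P - {\<gamma> s})))"
    have T: "T - {0} = \<phi> ` (U \<inter> R)"
    proof -
      \<comment> \<open>By injectivity of the chart only \<open>\<gamma> s\<close> is sent to 0, and
        \<open>\<gamma> s\<close> lies outside \<open>R\<close>.\<close>
      have "0 \<notin> \<phi> ` (U \<inter> R)"
        using p UR(2) inj by (metis IntD1 IntD2 imageE inj_onD)
      then show ?thesis by (simp add: T_def UR(1) p(2))
    qed
    have "openin X R" unfolding R_def by (rule op) simp
    then have hol: "(\<lambda>z. K (inv_into U \<phi> z) $ i $ j) holomorphic_on T - {0}"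
      if "\<And>i j. holomorphic_on_surface A (\<lambda>x. K x $ i $ j) R" for K :: "'a \<Rightarrow> complex^'n^'n" and i j
      using holomorphic_on_surface_compatible_chart[OF rs ch that] T by (simp add: o_def)
    have skew: "K (inv_into U \<phi> z) \<in> so_algebra"
      if "\<forall>x\<in>R. K x \<in> so_algebra" "z \<in> T - {0}" for K :: "'a \<Rightarrow> complex^'n^'n" and z
      using that inj unfolding T by auto
    show "tyurin_expansion c (\<alpha> s) (\<lambda>x. L x ** L' x - L' x ** L x)"
      unfolding \<open>c = (U, \<phi>)\<close>
    proof (rule tyurin_expansion_commutator[of T])
      show "open T" unfolding T_def by (intro complex_chart_open_image[OF ch(1)] op) auto
      show "0 \<in> T" using p by (simp add: T_def UR(1))
      show "scalar_product (\<alpha> s) (\<alpha> s) = 0"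
        using assms(5) s by (simp add: tyurin_parameters_def)
      show "tyurin_expansion (U, \<phi>) (\<alpha> s) L" "tyurin_expansion (U, \<phi>) (\<alpha> s) L'"
        using L L' s c by simp_all
    qed (use L L' in \<open>simp_all add: hol skew\<close>)
  qed
qed

end
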